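(* Consider the infinite-horizon constrained risk-sensitive Markov decision problem $(P):\ \min_{\pi\in\mathcal{F}} J^{\pi}_{\gamma,R}(x)$ and, for each integer $T\ge 1$, the finite-horizon problems $(P_T^-):\ \min_{\pi\in\mathcal{F}^-_T} J^{\pi}_{\gamma,R,T}(x)$ and $(P_T^+):\ \min_{\pi\in\mathcal{F}^+_T} J^{\pi}_{\gamma,R,T}(x)$, with all data as defined in the context. (1) If $\mathcal{F}\neq\varnothing$, then $(P)$ has a solution (i.e. the minimum is attained by some policy in $\mathcal{F}$) and, for each integer $T>0$, $(P_T^+)$ has a solution. (2) If $\mathcal{F}^-_{T^*}\neq\varnothing$ for some integer $T^*>0$, then $\mathcal{F}\neq\varnothing$, and $(P_T^-)$ has a solution for each integer $T\ge T^*$.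
   Context: **MDP.** $\mathcal{S}=\{s_1,\dots,s_m\}$ and $\mathcal{A}=\{a_1,\dots,a_n\}$ are finite sets of states and actions; $p(s'|s,a)$ is a (time-homogeneous) transition probability from $s$ to $s'$ under action $a$. A Markovian randomized (MR) decision rule $d$ assigns to each state $s$ a probability distribution $d(\cdot|s)$ on $\mathcal{A}$. An MR policy is a sequence $\pi=\{d_t\}_{t=0}^\infty$ of MR decision rules; $\Pi_{\rm MR}$ is the set of all MR policies. For $x\in\mathcal{S}$, $\mathbb{E}^\pi_x$ denotes expectation for the process $(X_t,A_t)_{t\ge0}$ with $X_0=x$, $A_t\sim d_t(\cdot|X_t)$, $X_{t+1}\sim p(\cdot|X_t,A_t)$. **Costs.** Fix a discount factor $\beta\in(0,1)$ and a risk factor $\gamma\in\mathbb{R}\setminus\{0\}$. For an immediate cost function $R:\mathcal{S}\times\mathcal{A}\to\mathbb{R}$, $x\in\mathcal S$ and integer $T\ge1$, $$J^{\pi}_{\gamma,R}(x)=\mathbb{E}^\pi_x\Big[e^{\gamma\sum_{t=0}^{\infty}\beta^tR(X_t,A_t)}\Big],\quad J^{\pi}_{\gamma,R,T}(x)=\mathbb{E}^\pi_x\Big[e^{\gamma\sum_{t=0}^{T-1}\beta^tR(X_t,A_t)}\Big],$$ $$v^{\pi}_{R}(x)=\mathbb{E}^\pi_x\Big[\sum_{t=0}^{\infty}\beta^tR(X_t,A_t)\Big],\quad v^{\pi}_{R,T}(x)=\mathbb{E}^\pi_x\Big[\sum_{t=0}^{T-1}\beta^tR(X_t,A_t)\Big].$$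 **Constraints.** Fix the initial state $x\in\mathcal{S}$, an objective immediate cost $R$, nonnegative integers $M,\hat M,\bar M,\check M$, at least one nonzero, immediate cost functions $C_i,\hat C_j,\bar C_k,\check C_l:\mathcal{S}\times\mathcal{A}\to\mathbb{R}$, real constants $b_i,\hat b_j,\bar b_k,\check b_l$ and finite horizons (positive integers) $\bar T_k,\check T_l$, where $1\le i\le M$, $1\le j\le\hat M$, $1\le k\le\bar M$, $1\le l\le\check M$. Let $C>0$ be a common bound on the absolute values of all these immediate cost functions (including $R$), $K=C/(1-\beta)$, and $K_T=e^{|\gamma|K\beta^T}$. Define subsets of $\Pi_{\rm MR}$: - $\mathcal{C}=\{\pi: v^\pi_{C_i}(x)\le b_i\ \forall i\}$, $\hat{\mathcal{C}}=\{\pi: J^\pi_{\gamma,\hat C_j}(x)\le\hat b_j\ \forall j\}$, - $\bar{\mathcal{C}}=\{\pi: v^\pi_{\bar C_k,\bar T_k}(x)\le\bar b_k\ \forall k\}$, $\check{\mathcal{C}}=\{\pi: J^\pi_{\gamma,\check C_l,\check T_l}(x)\le\check b_l\ \forall l\}$, - $\mathcal{C}^-_T=\{\pi: v^\pi_{C_i,T}(x)\le b_i-K\beta^T\ \forall i\}$, $\hat{\mathcal{C}}^-_T=\{\pi: J^\pi_{\gamma,\hat C_j,T}(x)\le\hat b_j/K_T\ \forall j\}$, - $\mathcal{C}^+_T=\{\pi: v^\pi_{C_i,T}(x)\le b_i+K\beta^T\ \forall i\}$, $\hat{\mathcal{C}}^+_T=\{\pi: J^\pi_{\gamma,\hat C_j,T}(x)\le\hat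 b_jK_T\ \forall j\}$. Set $\mathcal{F}=\mathcal{C}\cap\hat{\mathcal{C}}\cap\bar{\mathcal{C}}\cap\check{\mathcal{C}}$, $\mathcal{F}^-_T=\mathcal{C}^-_T\cap\hat{\mathcal{C}}^-_T\cap\bar{\mathcal{C}}\cap\check{\mathcal{C}}$, $\mathcal{F}^+_T=\mathcal{C}^+_T\cap\hat{\mathcal{C}}^+_T\cap\bar{\mathcal{C}}\cap\check{\mathcal{C}}$. *)

theory Defs
  imports "HOL-Probability.Probability"
begin

text \<open>States and actions are finite types \<open>'s\<close>, \<open>'a\<close>. A Markovian randomized policy gives, for each
  time \<open>t\<close> and state \<open>s\<close>, the distribution \<open>\<pi> t s\<close> of the action; the set of all these policies is
  the whole type \<open>('s, 'a) mr_policy\<close>.\<close>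

type_synonym ('s, 'a) mr_policy = "nat \<Rightarrow> 's \<Rightarrow> 'a pmf"

text \<open>Conditional law of \<open>(X\<^sub>t, A\<^sub>t)\<close> given the pairs \<open>\<omega> 0, \<dots>, \<omega> (t - 1)\<close> observed before time \<open>t\<close>.\<close>

definition mdp_kernel ::
  "('s \<Rightarrow> 'a \<Rightarrow> 's pmf) \<Rightarrow> ('s, 'a) mr_policy \<Rightarrow> 's \<Rightarrow> nat \<Rightarrow> (nat \<Rightarrow> 's \<times> 'a) \<Rightarrow> ('s \<times> 'a) measure"
where
  "mdp_kernel p \<pi> x t \<omega> = measure_pmf (bind_pmf
     (case t of 0 \<Rightarrow> return_pmf x | Suc n \<Rightarrow> p (fst (\<omega> n)) (snd (\<omega> n)))
     (\<lambda>s. map_pmf (Pair s) (\<pi> t s)))"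

lemma Ionescu_Tulcea_mdp_kernel:
  fixes p :: "'s::finite \<Rightarrow> 'a::finite \<Rightarrow> 's pmf"
  shows "Ionescu_Tulcea (mdp_kernel p \<pi> x) (\<lambda>_. count_space UNIV)"
proof (rule Ionescu_Tulcea.intro)
  fix t :: nat
  show "mdp_kernel p \<pi> x t \<in> PiM {0..<t} (\<lambda>_. count_space UNIV) \<rightarrow>\<^sub>M subprob_algebra (count_space UNIV)"
  proof (cases t)
    case 0
    then show ?thesis
      by (auto simp: mdp_kernel_def[abs_def] space_subprob_algebra
          intro!: measurable_const prob_space_imp_subprob_space prob_space_measure_pmf)
  next
    case (Suc n)
    let ?g = "\<lambda>z. measure_pmf (bind_pmf (p (fst z) (snd z)) (\<lambda>s. map_pmf (Pair s) (\<pi> t s)))"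
    have "(\<lambda>\<omega>. \<omega> n) \<in> PiM {0..<t} (\<lambda>_. count_space UNIV) \<rightarrow>\<^sub>M (count_space UNIV :: ('s \<times> 'a) measure)"
      using Suc by (intro measurable_component_singleton) auto
    moreover have "?g \<in> count_space UNIV \<rightarrow>\<^sub>M subprob_algebra (count_space UNIV)"
      by (auto simp: space_subprob_algebra
          intro!: prob_space_imp_subprob_space prob_space_measure_pmf)
    ultimately have "(\<lambda>\<omega>. ?g (\<omega> n)) \<in> PiM {0..<t} (\<lambda>_. count_space UNIV) \<rightarrow>\<^sub>M subprob_algebra (count_space UNIV)"
      by (rule measurable_compose)
    then show ?thesis
      using Suc by (simp add: mdp_kernel_def[abs_def])
  qed
qed (unfold mdp_kernel_def, rule prob_space_measure_pmf)

text \<open>Law of the whole process \<open>(X\<^sub>t, A\<^sub>t)\<^sub>t\<close> with \<open>X\<^sub>0 = x\<close>: the Ionescu-Tulcea measure of the kernels above,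
  on the product sigma-algebra of \<open>nat \<Rightarrow> 's \<times> 'a\<close>.\<close>

definition mdp_measure ::
  "('s::finite \<Rightarrow> 'a::finite \<Rightarrow> 's pmf) \<Rightarrow> ('s, 'a) mr_policy \<Rightarrow> 's \<Rightarrow> (nat \<Rightarrow> 's \<times> 'a) measure"
where
  "mdp_measure p \<pi> x = projective_family.lim UNIV
     (Ionescu_Tulcea.CI (mdp_kernel p \<pi> x) (\<lambda>_. count_space UNIV)) (\<lambda>_. count_space UNIV)"

lemma
  fixes p :: "'s::finite \<Rightarrow> 'a::finite \<Rightarrow> 's pmf"
  shows prob_space_mdp_measure: "prob_space (mdp_measure p \<pi> x)"
    and sets_mdp_measure: "sets (mdp_measure p \<pi> x) = sets (PiM UNIV (\<lambda>_. count_space UNIV))"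
    and distr_mdp_measure: "finite I \<Longrightarrow>
      distr (mdp_measure p \<pi> x) (PiM I (\<lambda>_. count_space UNIV)) (\<lambda>\<omega>. restrict \<omega> I) =
      Ionescu_Tulcea.CI (mdp_kernel p \<pi> x) (\<lambda>_. count_space UNIV) I"
proof -
  interpret IT: Ionescu_Tulcea "mdp_kernel p \<pi> x" "\<lambda>_. count_space UNIV"
    by (rule Ionescu_Tulcea_mdp_kernel)
  have lim: "mdp_measure p \<pi> x = IT.PF.lim"
    by (simp add: mdp_measure_def)
  show "sets (mdp_measure p \<pi> x) = sets (PiM UNIV (\<lambda>_. count_space UNIV))"
    by (simp add: lim IT.PF.sets_lim)
  show D: "distr (mdp_measure p \<pi> x) (PiM I (\<lambda>_. count_space UNIV)) (\<lambda>\<omega>. restrict \<omega> I) = IT.CI I"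
    if "finite I" for I
    using that by (simp add: lim IT.distr_lim)
  have "prob_space (IT.CI {})"
    by (rule IT.PF.prob_space_P) auto
  then show "prob_space (mdp_measure p \<pi> x)"
    unfolding D[of "{}", symmetric, OF finite.emptyI]
    by (rule prob_space_distrD[rotated])
       (simp add: lim measurable_cong_sets[OF IT.PF.sets_lim refl] measurable_restrict_subset)
qed

definition risk_cost :: "('s::finite \<Rightarrow> 'a::finite \<Rightarrow> 's pmf) \<Rightarrow> real \<Rightarrow> real \<Rightarrow> 's \<Rightarrow>
    ('s \<times> 'a \<Rightarrow> real) \<Rightarrow> ('s, 'a) mr_policy \<Rightarrow> real" where
  "risk_cost p \<beta> \<gamma> x R \<pi> = (\<integral>\<omega>. exp (\<gamma> * (\<Sum>t. \<beta> ^ t * R (\<omega> t))) \<partial>mdp_measure p \<pi> x)"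

definition risk_cost_fin :: "('s::finite \<Rightarrow> 'a::finite \<Rightarrow> 's pmf) \<Rightarrow> real \<Rightarrow> real \<Rightarrow> 's \<Rightarrow>
    nat \<Rightarrow> ('s \<times> 'a \<Rightarrow> real) \<Rightarrow> ('s, 'a) mr_policy \<Rightarrow> real" where
  "risk_cost_fin p \<beta> \<gamma> x T R \<pi> = (\<integral>\<omega>. exp (\<gamma> * (\<Sum>t<T. \<beta> ^ t * R (\<omega> t))) \<partial>mdp_measure p \<pi> x)"

definition disc_cost :: "('s::finite \<Rightarrow> 'a::finite \<Rightarrow> 's pmf) \<Rightarrow> real \<Rightarrow> 's \<Rightarrow>
    ('s \<times> 'a \<Rightarrow> real) \<Rightarrow> ('s, 'a) mr_policy \<Rightarrow> real" where
  "disc_cost p \<beta> x R \<pi> = (\<integral>\<omega>. (\<Sum>t. \<beta> ^ t * R (\<omega> t)) \<partial>mdp_measure p \<pi> x)"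

definition disc_cost_fin :: "('s::finite \<Rightarrow> 'a::finite \<Rightarrow> 's pmf) \<Rightarrow> real \<Rightarrow> 's \<Rightarrow>
    nat \<Rightarrow> ('s \<times> 'a \<Rightarrow> real) \<Rightarrow> ('s, 'a) mr_policy \<Rightarrow> real" where
  "disc_cost_fin p \<beta> x T R \<pi> = (\<integral>\<omega>. (\<Sum>t<T. \<beta> ^ t * R (\<omega> t)) \<partial>mdp_measure p \<pi> x)"

end

theory Submission
  imports Defs
begin

text \<open>
  The minima exist because policies form a compact space on which all costs are continuous, so it
  only remains to see that the feasible sets are closed and nonempty.

  A policy is the family of its action probabilities. In the product topology these families form
  a closed subset of a cube, hence a compact set (\<open>compact_range_action_probs\<close>). The probability of a
  history of length \<open>T\<close> is a product of transition probabilities and action probabilities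
  (\<open>measure_history\<close>), so a finite-horizon cost, being a finite sum over histories, is a polynomial in
  finitely many coordinates and thus continuous. Truncating an infinite-horizon cost at \<open>T\<close> changes
  the discounted sum by at most \<open>K * \<beta>\<^sup>T\<close> on every path. This shifts the risk-neutral cost by at most
  \<open>K * \<beta>\<^sup>T\<close> and multiplies the risk-sensitive cost by a factor between \<open>1 / K\<^sub>T\<close> and \<open>K\<^sub>T\<close>, for all
  policies at once. The infinite-horizon costs are therefore uniform limits of continuous functions,
  and continuous themselves. Feasible sets, given by weak inequalities between continuous functions
  and constants, are closed, and a continuous function attains its minimum on such a set if the
  set is nonempty (\<open>policy_continuous_attains_min\<close>).

  The same truncation estimates settle nonemptiness. They give \<open>F\<^sup>-\<^sub>T \<subseteq> F \<subseteq> F\<^sup>+\<^sub>T\<close> for every \<open>T\<close>, and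
  applied between two finite horizons \<open>S \<le> T\<close> they give \<open>F\<^sup>-\<^sub>S \<subseteq> F\<^sup>-\<^sub>T\<close>.
\<close>

section \<open>The compact space of policies\<close>

text \<open>Listing a policy's action probabilities identifies the policies with a set of real families indexed
  by \<open>(t, s, a)\<close>. This transfers the product topology, in which convergence means convergence of
  every single action probability, to policies.\<close>

definition action_probs :: "('s, 'a) mr_policy \<Rightarrow> nat \<times> 's \<times> 'a \<Rightarrow> real" where
  "action_probs \<pi> = (\<lambda>(t, s, a). pmf (\<pi> t s) a)"

lemma inj_action_probs: "inj (action_probs :: ('s, 'a) mr_policy \<Rightarrow> _)"
proof (rule injI)
  fix \<pi> \<pi>' :: "('s, 'a) mr_policy" assume *: "action_probs \<pi> = action_probs \<pi>'"
  have "pmf (\<pi> t s) a = pmf (\<pi>' t s) a" for t s a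
    using fun_cong[OF *, of "(t, s, a)"] by (simp add: action_probs_def)
  then show "\<pi> = \<pi>'" by (intro ext pmf_eqI)
qed

lemma range_action_probs:
  "range (action_probs :: ('s::finite, 'a::finite) mr_policy \<Rightarrow> _) =
    {\<theta>. (\<forall>i. 0 \<le> \<theta> i) \<and> (\<forall>t s. (\<Sum>a\<in>UNIV. \<theta> (t, s, a)) = 1)}" (is "?L = ?R")
proof (intro set_eqI iffI)
  fix \<theta> assume "\<theta> \<in> ?L"
  then show "\<theta> \<in> ?R"
    by (auto simp: action_probs_def sum_pmf_eq_1)
next
  fix \<theta> :: "nat \<times> 's \<times> 'a \<Rightarrow> real" assume \<theta>: "\<theta> \<in> ?R"
  have "pmf (embed_pmf (\<lambda>a. \<theta> (t, s, a))) a = \<theta> (t, s, a)" for t s a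
    using \<theta> by (intro pmf_embed_pmf) (auto simp: nn_integral_count_space_finite sum_ennreal)
  then have "\<theta> = action_probs (\<lambda>t s. embed_pmf (\<lambda>a. \<theta> (t, s, a)))"
    by (auto simp: action_probs_def)
  then show "\<theta> \<in> ?L" by blast
qed

text \<open>By Tychonoff the cube \<open>[0, 1]\<^bsup>nat \<times> 's \<times> 'a\<^esup>\<close> is compact. The families that come from policies are cut out
  of it by conditions each of which involves finitely many coordinates. Finiteness of the action
  set matters here: the normalisation \<open>\<Sum>a. \<theta> (t, s, a) = 1\<close> is then a closed condition, so that no
  probability mass can escape in a limit.\<close>

lemma compact_range_action_probs:
  "compact (range (action_probs :: ('s::finite, 'a::finite) mr_policy \<Rightarrow> _))"
proof -
  have "compactin (product_topology (\<lambda>i. euclidean) UNIV)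
      (PiE UNIV (\<lambda>_. {0..1}) :: (nat \<times> 's \<times> 'a \<Rightarrow> real) set)"
    by (simp add: compactin_PiE)
  then have cube: "compact (PiE UNIV (\<lambda>_. {0..1}) :: (nat \<times> 's \<times> 'a \<Rightarrow> real) set)"
    by (simp add: euclidean_product_topology)
  have "closed {\<theta> :: nat \<times> 's \<times> 'a \<Rightarrow> real. (\<forall>i. 0 \<le> \<theta> i) \<and> (\<forall>t s. (\<Sum>a\<in>UNIV. \<theta> (t, s, a)) = 1)}"
    by (intro closed_Collect_conj closed_Collect_all closed_Collect_le closed_Collect_eq
        continuous_intros continuous_on_product_coordinates)
  then have "closed (range (action_probs :: ('s, 'a) mr_policy \<Rightarrow> _))"
    by (simp add: range_action_probs)
  moreover have "range (action_probs :: ('s, 'a) mr_policy \<Rightarrow> _) \<subseteq> PiE UNIV (\<lambda>_. {0..1})"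
    by (auto simp: action_probs_def pmf_le_1)
  ultimately show ?thesis
    using cube compact_Int_closed by (metis inf.absorb_iff2)
qed

text \<open>Continuity and closedness for the topology carried over along \<^const>\<open>action_probs\<close>. Both
  are phrased on the image, where the product topology lives.\<close>

definition policy_continuous :: "(('s, 'a) mr_policy \<Rightarrow> real) \<Rightarrow> bool" where
  "policy_continuous f \<longleftrightarrow> continuous_on (range action_probs) (f \<circ> inv action_probs)"

definition policy_closed :: "('s, 'a) mr_policy set \<Rightarrow> bool" where
  "policy_closed A \<longleftrightarrow> closed (action_probs ` A)"

lemma policy_continuous_action_prob: "policy_continuous (\<lambda>\<pi>. pmf (\<pi> t s) a)"
proof -
  have "continuous_on (range action_probs) (\<lambda>\<theta> :: nat \<times> 'a \<times> 'b \<Rightarrow> real. \<theta> (t, s, a))"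
    by (rule continuous_on_subset[OF continuous_on_product_coordinates]) simp
  moreover have "pmf (inv action_probs \<theta> t s) a = \<theta> (t, s, a)" if "\<theta> \<in> range action_probs" for \<theta>
    using f_inv_into_f[OF that] unfolding action_probs_def by (metis case_prod_conv)
  ultimately show ?thesis
    unfolding policy_continuous_def by (simp cong: continuous_on_cong)
qed

text \<open>The shape in which finite-horizon expectations appear: \<open>h\<close> runs through histories, \<open>c h\<close> is the
  cost of a history, \<open>d h t\<close> a transition probability and \<open>f h t \<pi>\<close> an action probability.\<close>

lemma policy_continuous_polynomial:
  assumes "\<And>h t. h \<in> H \<Longrightarrow> t \<in> I \<Longrightarrow> policy_continuous (f h t)"
  shows "policy_continuous (\<lambda>\<pi>. \<Sum>h\<in>H. c h * (\<Prod>t\<in>I. d h t * f h t \<pi>))"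
  using assms unfolding policy_continuous_def o_def
  by (intro continuous_intros) auto

lemma policy_continuous_uniform_limit:
  assumes "\<And>n. policy_continuous (f n)"
    and "e \<longlonglongrightarrow> 0" and "\<And>n \<pi>. \<bar>f n \<pi> - g \<pi>\<bar> \<le> e n"
  shows "policy_continuous g"
  unfolding policy_continuous_def
proof (rule uniform_limit_theorem[OF _ _ sequentially_bot])
  show "\<forall>\<^sub>F n in sequentially. continuous_on (range action_probs) (f n \<circ> inv action_probs)"
    using assms(1) by (simp add: policy_continuous_def)
  show "uniform_limit (range action_probs) (\<lambda>n. f n \<circ> inv action_probs) (g \<circ> inv action_probs) sequentially"
  proof (rule uniform_limitI)
    fix r :: real assume "0 < r"
    then have "\<forall>\<^sub>F n in sequentially. e n < r" using assms(2) by (simp add: order_tendstoD)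
    then show "\<forall>\<^sub>F n in sequentially. \<forall>\<theta>\<in>range action_probs.
        dist ((f n \<circ> inv action_probs) \<theta>) ((g \<circ> inv action_probs) \<theta>) < r"
      by eventually_elim (auto simp: dist_real_def intro: le_less_trans[OF assms(3)])
  qed
qed

lemma policy_closed_sublevel:
  fixes f :: "'i \<Rightarrow> ('s::finite, 'a::finite) mr_policy \<Rightarrow> real"
  assumes "\<And>i. i \<in> A \<Longrightarrow> policy_continuous (f i)"
  shows "policy_closed {\<pi>. \<forall>i\<in>A. f i \<pi> \<le> c i}"
proof -
  note inv = inv_f_f[OF inj_action_probs]
  let ?\<Theta> = "range (action_probs :: ('s, 'a) mr_policy \<Rightarrow> _)"
  have cl: "closed ?\<Theta>" by (intro compact_imp_closed compact_range_action_probs)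
  have "closed {\<theta> \<in> ?\<Theta>. (f i \<circ> inv action_probs) \<theta> \<le> c i}" if "i \<in> A" for i
    by (rule continuous_on_closed_Collect_le[OF _ _ cl])
       (use assms[OF that] in \<open>simp_all add: policy_continuous_def\<close>)
  moreover have "action_probs ` {\<pi>. \<forall>i\<in>A. f i \<pi> \<le> c i} =
      ?\<Theta> \<inter> (\<Inter>i\<in>A. {\<theta> \<in> ?\<Theta>. (f i \<circ> inv action_probs) \<theta> \<le> c i})"
    by (auto simp: inv)
  ultimately show ?thesis
    unfolding policy_closed_def using cl by auto
qed

lemma policy_closed_Int: "policy_closed A \<Longrightarrow> policy_closed B \<Longrightarrow> policy_closed (A \<inter> B)"
  unfolding policy_closed_def image_Int[OF inj_action_probs] by (rule closed_Int)

lemma policy_continuous_attains_min: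
  fixes f :: "('s::finite, 'a::finite) mr_policy \<Rightarrow> real"
  assumes "policy_continuous f" "policy_closed A" "A \<noteq> {}"
  shows "\<exists>\<pi>. is_arg_min f (\<lambda>\<pi>. \<pi> \<in> A) \<pi>"
proof -
  note inv = inv_f_f[OF inj_action_probs]
  have "compact (range action_probs \<inter> action_probs ` A)"
    using assms(2) unfolding policy_closed_def
    by (intro compact_Int_closed compact_range_action_probs)
  then have "compact (action_probs ` A)"
    by (simp add: Int_absorb1 image_mono)
  moreover have "continuous_on (action_probs ` A) (f \<circ> inv action_probs)"
    using assms(1) unfolding policy_continuous_def by (rule continuous_on_subset) auto
  ultimately obtain \<theta> where "\<theta> \<in> action_probs ` A"
    "\<forall>\<eta>\<in>action_probs ` A. (f \<circ> inv action_probs) \<theta> \<le> (f \<circ> inv action_probs) \<eta>"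
    using continuous_attains_inf[of "action_probs ` A"] assms(3) by blast
  then show ?thesis by (auto simp: is_arg_min_def inv not_less)
qed

section \<open>Probabilities of finite histories\<close>

text \<open>The factor of the probability of a history that the policy cannot influence: the chance of
  entering the state of \<open>h\<close> at time \<open>t\<close>, given the pair at time \<open>t - 1\<close> (at time \<open>0\<close>, the initial
  state).\<close>

definition entry_prob :: "('s \<Rightarrow> 'a \<Rightarrow> 's pmf) \<Rightarrow> 's \<Rightarrow> nat \<Rightarrow> (nat \<Rightarrow> 's \<times> 'a) \<Rightarrow> real" where
  "entry_prob p x t h =
    pmf (case t of 0 \<Rightarrow> return_pmf x | Suc n \<Rightarrow> p (fst (h n)) (snd (h n))) (fst (h t))"

lemma pmf_bind_map_Pair:
  "pmf (bind_pmf q (\<lambda>s. map_pmf (Pair s) (r s))) (s, a) = pmf q s * pmf (r s) a"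
proof -
  have "pmf (map_pmf (Pair s') (r s')) (s, a) = indicator {s} s' * pmf (r s) a" for s'
  proof (cases "s' = s")
    case True then show ?thesis by (simp add: pmf_map_inj' inj_on_def)
  next
    case False
    then show ?thesis by (simp add: pmf_map_outside image_iff)
  qed
  then show ?thesis by (simp add: pmf_bind measure_pmf_single)
qed

lemma emeasure_mdp_kernel_single:
  "emeasure (mdp_kernel p \<pi> x t h) {h t} =
    ennreal (entry_prob p x t h * pmf (\<pi> t (fst (h t))) (snd (h t)))"
  unfolding mdp_kernel_def entry_prob_def
  by (subst emeasure_pmf_single, subst (2) prod.collapse[symmetric], subst pmf_bind_map_Pair) simp

text \<open>One step of the Ionescu-Tulcea construction appends a pair, drawn from the kernel, to the
  history of length \<open>n\<close>. A given history of length \<open>n + 1\<close> can only arise from its own restriction,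
  so the integral over the shorter histories collapses to a single term and the probabilities
  multiply.\<close>

lemma emeasure_mdp_kernel_history:
  fixes p :: "'s::finite \<Rightarrow> 'a::finite \<Rightarrow> 's pmf"
  assumes "h \<in> extensional {0..<n}"
  shows "emeasure (Ionescu_Tulcea.C (mdp_kernel p \<pi> x) (\<lambda>_. count_space UNIV) 0 n (\<lambda>_. undefined)) {h} =
    ennreal (\<Prod>t<n. entry_prob p x t h * pmf (\<pi> t (fst (h t))) (snd (h t)))"
proof -
  interpret IT: Ionescu_Tulcea "mdp_kernel p \<pi> x" "\<lambda>_. count_space UNIV"
    by (rule Ionescu_Tulcea_mdp_kernel)
  let ?M = "\<lambda>n. PiM {0..<n} (\<lambda>_. count_space UNIV) :: (nat \<Rightarrow> 's \<times> 'a) measure"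
  let ?q = "\<lambda>h t. entry_prob p x t h * pmf (\<pi> t (fst (h t))) (snd (h t))"
  have single: "{h} \<in> sets (?M n)" if "h \<in> extensional {0..<n}" for h n
  proof -
    have "{h} = PiE {0..<n} (\<lambda>i. {h i})"
      using that by (auto simp: PiE_singleton)
    also have "\<dots> \<in> sets (?M n)" by (intro sets_PiM_I_finite) auto
    finally show ?thesis .
  qed
  have q_nonneg: "0 \<le> ?q h t" for h t by (simp add: entry_prob_def)
  show ?thesis
    using assms
  proof (induction n arbitrary: h)
    case 0
    then have "h = (\<lambda>_. undefined)" by simp
    then show ?case using single[of h 0] 0 by simp
  next
    case (Suc n)
    let ?h = "restrict h {0..<n}"
    have step: "emeasure (IT.eP n \<omega>) {h} = ennreal (?q h n) * indicator {?h} \<omega>"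
      if "\<omega> \<in> space (IT.C 0 n (\<lambda>_. undefined))" for \<omega>
    proof -
      have \<omega>: "\<omega> \<in> space (?M n)" using that by (simp add: IT.space_C)
      then have ext: "\<omega> \<in> extensional {0..<n}" by (simp add: space_PiM PiE_def)
      have "emeasure (IT.eP n \<omega>) {h} = emeasure (mdp_kernel p \<pi> x n \<omega>) ((\<lambda>z. fun_upd \<omega> n z) -` {h})"
        using IT.emeasure_eP[OF \<omega> single[OF Suc.prems]] by simp
      also have "\<dots> = ennreal (?q h n) * indicator {?h} \<omega>"
      proof (cases "\<omega> = ?h")
        case True
        have "fun_upd ?h n z = h \<longleftrightarrow> z = h n" for z
          using Suc.prems by (auto simp: fun_eq_iff extensional_def restrict_def)
        then have "(\<lambda>z. fun_upd \<omega> n z) -` {h} = {h n}" by (auto simp: True)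
        moreover have "mdp_kernel p \<pi> x n \<omega> = mdp_kernel p \<pi> x n h"
          by (cases n) (auto simp: mdp_kernel_def True)
        ultimately show ?thesis
          using True by (simp add: emeasure_mdp_kernel_single)
      next
        case False
        have "fun_upd \<omega> n z \<noteq> h" for z
        proof
          assume "fun_upd \<omega> n z = h"
          then have h: "h = fun_upd \<omega> n z" by simp
          have "\<omega> = ?h"
            using ext unfolding h by (auto simp: fun_eq_iff extensional_def)
          with False show False ..
        qed
        then have "(\<lambda>z. fun_upd \<omega> n z) -` {h} = {}" by auto
        then show ?thesis using False by simp
      qed
      finally show ?thesis .
    qed
    have "emeasure (IT.C 0 (Suc n) (\<lambda>_. undefined)) {h} =
        (\<integral>\<^sup>+\<omega>. emeasure (IT.eP n \<omega>) {h} \<partial>IT.C 0 n (\<lambda>_. undefined))"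
      unfolding IT.C.simps add_0
    proof (rule emeasure_bind)
      show "space (IT.C 0 n (\<lambda>_. undefined)) \<noteq> {}"
        by (simp add: IT.space_C space_PiM PiE_eq_empty_iff)
      show "IT.eP n \<in> IT.C 0 n (\<lambda>_. undefined) \<rightarrow>\<^sub>M subprob_algebra (?M (Suc n))"
        using IT.measurable_eP[of n] by (simp add: measurable_cong_sets[OF IT.sets_C refl])
    qed (rule single[OF Suc.prems])
    also have "\<dots> = (\<integral>\<^sup>+\<omega>. ennreal (?q h n) * indicator {?h} \<omega> \<partial>IT.C 0 n (\<lambda>_. undefined))"
      by (intro nn_integral_cong step)
    also have "\<dots> = ennreal (?q h n) * emeasure (IT.C 0 n (\<lambda>_. undefined)) {?h}"
      using single[of ?h n] by (intro nn_integral_cmult_indicator) (simp add: IT.sets_C)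
    also have "\<dots> = ennreal (?q h n) * ennreal (\<Prod>t<n. ?q ?h t)"
      by (subst Suc.IH) auto
    also have "(\<Prod>t<n. ?q ?h t) = (\<Prod>t<n. ?q h t)"
      by (intro prod.cong) (auto simp: entry_prob_def split: nat.split)
    also have "ennreal (?q h n) * ennreal (\<Prod>t<n. ?q h t) = ennreal (\<Prod>t<Suc n. ?q h t)"
      by (simp add: ennreal_mult[symmetric] q_nonneg prod_nonneg mult.commute)
    finally show ?case .
  qed
qed

lemma measurable_mdp_measure:
  fixes p :: "'s::finite \<Rightarrow> 'a::finite \<Rightarrow> 's pmf"
  shows "measurable (mdp_measure p \<pi> x) N = measurable (PiM UNIV (\<lambda>_. count_space UNIV)) N"
  by (rule measurable_cong_sets[OF sets_mdp_measure refl])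

lemma
  fixes p :: "'s::finite \<Rightarrow> 'a::finite \<Rightarrow> 's pmf"
  assumes h: "h \<in> extensional {0..<n}"
  shows sets_history: "{\<omega>. restrict \<omega> {0..<n} = h} \<in> sets (mdp_measure p \<pi> x)"
    and measure_history: "measure (mdp_measure p \<pi> x) {\<omega>. restrict \<omega> {0..<n} = h} =
      (\<Prod>t<n. entry_prob p x t h * pmf (\<pi> t (fst (h t))) (snd (h t)))"
proof -
  interpret IT: Ionescu_Tulcea "mdp_kernel p \<pi> x" "\<lambda>_. count_space UNIV"
    by (rule Ionescu_Tulcea_mdp_kernel)
  let ?M = "PiM {0..<n} (\<lambda>_. count_space UNIV) :: (nat \<Rightarrow> 's \<times> 'a) measure"
  let ?P = "mdp_measure p \<pi> x"
  have space: "space ?P = UNIV"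
    using sets_eq_imp_space_eq[OF sets_mdp_measure, of p \<pi> x] by (simp add: space_PiM)
  have "{h} = PiE {0..<n} (\<lambda>i. {h i})" using h by (auto simp: PiE_singleton)
  also have "\<dots> \<in> sets ?M" by (intro sets_PiM_I_finite) auto
  finally have single: "{h} \<in> sets ?M" .
  have restr: "(\<lambda>\<omega>. restrict \<omega> {0..<n}) \<in> ?P \<rightarrow>\<^sub>M ?M"
    by (simp add: measurable_mdp_measure measurable_restrict_subset)
  have eq: "(\<lambda>\<omega>. restrict \<omega> {0..<n}) -` {h} \<inter> space ?P = {\<omega>. restrict \<omega> {0..<n} = h}"
    by (auto simp: space)
  show "{\<omega>. restrict \<omega> {0..<n} = h} \<in> sets ?P"
    using measurable_sets[OF restr single] unfolding eq .
  have "emeasure ?P {\<omega>. restrict \<omega> {0..<n} = h} = emeasure (IT.CI {0..<n}) {h}"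
    using emeasure_distr[OF restr single] distr_mdp_measure[of "{0..<n}" p \<pi> x] unfolding eq by simp
  also have "\<dots> = emeasure (IT.C 0 n (\<lambda>_. undefined)) {h}"
    using IT.emeasure_CI[of "{0..<n}" n "{h}"] single h by (simp add: prod_emb_id PiE_def)
  finally show "measure ?P {\<omega>. restrict \<omega> {0..<n} = h} =
      (\<Prod>t<n. entry_prob p x t h * pmf (\<pi> t (fst (h t))) (snd (h t)))"
    by (simp add: measure_def emeasure_mdp_kernel_history[OF h] entry_prob_def prod_nonneg)
qed

text \<open>There are only finitely many histories of length \<open>n\<close>, so the expectation of a function of the
  history is a finite sum. This exhibits it as a polynomial in the action probabilities.\<close>

lemma integral_history:
  fixes p :: "'s::finite \<Rightarrow> 'a::finite \<Rightarrow> 's pmf" and g :: "(nat \<Rightarrow> 's \<times> 'a) \<Rightarrow> real"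
  shows "(\<integral>\<omega>. g (restrict \<omega> {0..<n}) \<partial>mdp_measure p \<pi> x) =
    (\<Sum>h\<in>PiE {0..<n} (\<lambda>_. UNIV). g h * (\<Prod>t<n. entry_prob p x t h * pmf (\<pi> t (fst (h t))) (snd (h t))))"
proof -
  interpret prob_space "mdp_measure p \<pi> x" by (rule prob_space_mdp_measure)
  let ?H = "PiE {0..<n} (\<lambda>_. UNIV) :: (nat \<Rightarrow> 's \<times> 'a) set"
  let ?E = "\<lambda>h. {\<omega> :: nat \<Rightarrow> 's \<times> 'a. restrict \<omega> {0..<n} = h}"
  have fin: "finite ?H" by (intro finite_PiE) auto
  have ext: "h \<in> ?H \<Longrightarrow> h \<in> extensional {0..<n}" for h by (auto simp: PiE_def)
  have "g (restrict \<omega> {0..<n}) = (\<Sum>h\<in>?H. g h * indicat_real (?E h) \<omega>)" for \<omega>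
  proof -
    have "(\<Sum>h\<in>?H. g h * indicat_real (?E h) \<omega>) = (\<Sum>h\<in>{restrict \<omega> {0..<n}}. g h * indicat_real (?E h) \<omega>)"
      using fin by (intro sum.mono_neutral_right) (auto simp: indicator_def)
    then show ?thesis by simp
  qed
  then have "(\<integral>\<omega>. g (restrict \<omega> {0..<n}) \<partial>mdp_measure p \<pi> x) =
      (\<integral>\<omega>. (\<Sum>h\<in>?H. g h * indicat_real (?E h) \<omega>) \<partial>mdp_measure p \<pi> x)" by simp
  also have "\<dots> = (\<Sum>h\<in>?H. g h * measure (mdp_measure p \<pi> x) (?E h))"
  proof (subst Bochner_Integration.integral_sum)
    fix h assume "h \<in> ?H"
    then show "integrable (mdp_measure p \<pi> x) (\<lambda>\<omega>. g h * indicat_real (?E h) \<omega>)"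
      using sets_history[OF ext] by (intro integrable_mult_right integrable_real_indicator)
        (auto simp: emeasure_eq_measure)
  next
    show "(\<Sum>h\<in>?H. \<integral>\<omega>. g h * indicat_real (?E h) \<omega> \<partial>mdp_measure p \<pi> x) =
      (\<Sum>h\<in>?H. g h * measure (mdp_measure p \<pi> x) (?E h))"
      using sets.sets_into_space[OF sets_history[OF ext]]
      by (intro sum.cong) (auto simp: Int_absorb2)
  qed
  also have "\<dots> = (\<Sum>h\<in>?H. g h * (\<Prod>t<n. entry_prob p x t h * pmf (\<pi> t (fst (h t))) (snd (h t))))"
    by (intro sum.cong) (simp_all add: measure_history[OF ext])
  finally show ?thesis .
qed

section \<open>Truncation of the horizon\<close>

text \<open>Discounted costs accrued between times \<open>S\<close> and \<open>T\<close> are bounded by the geometric sum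
  \<open>c * (\<beta>\<^sup>S + \<dots> + \<beta>\<^bsup>T - 1\<^esup>) = K * (\<beta>\<^sup>S - \<beta>\<^sup>T)\<close>. Keeping the term \<open>\<beta>\<^sup>T\<close> is what later makes the
  tightened feasible sets increase with the horizon.\<close>

lemma
  fixes r :: "nat \<Rightarrow> real"
  assumes \<beta>: "0 < \<beta>" "\<beta> < 1" and r: "\<And>t. \<bar>r t\<bar> \<le> c" and K: "K = c / (1 - \<beta>)"
  shows discounted_increment:
      "S \<le> T \<Longrightarrow> \<bar>(\<Sum>t<T. \<beta> ^ t * r t) - (\<Sum>t<S. \<beta> ^ t * r t)\<bar> \<le> K * (\<beta> ^ S - \<beta> ^ T)"
    and discounted_remainder: "\<bar>(\<Sum>t. \<beta> ^ t * r t) - (\<Sum>t<S. \<beta> ^ t * r t)\<bar> \<le> K * \<beta> ^ S"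
proof -
  have incr: "\<bar>(\<Sum>t<T. \<beta> ^ t * r t) - (\<Sum>t<S. \<beta> ^ t * r t)\<bar> \<le> K * (\<beta> ^ S - \<beta> ^ T)" if "S \<le> T" for T
    using that
  proof (induction rule: dec_induct)
    case (step n)
    have "\<bar>\<beta> ^ n * r n\<bar> \<le> \<beta> ^ n * c"
      using \<beta>(1) r[of n] by (simp add: abs_mult)
    moreover have "c = K * (1 - \<beta>)" using \<beta> K by simp
    then have "\<beta> ^ n * c = K * (\<beta> ^ n - \<beta> ^ Suc n)"
      by (simp only: power_Suc) (simp add: algebra_simps)
    ultimately show ?case using step.IH by (simp add: algebra_simps)
  qed simp
  then show "S \<le> T \<Longrightarrow> \<bar>(\<Sum>t<T. \<beta> ^ t * r t) - (\<Sum>t<S. \<beta> ^ t * r t)\<bar> \<le> K * (\<beta> ^ S - \<beta> ^ T)" .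
  have "0 \<le> c" using r[of 0] by linarith
  then have "0 \<le> K" using \<beta> K by simp
  have "summable (\<lambda>t. \<beta> ^ t * r t)"
  proof (rule summable_comparison_test)
    show "summable (\<lambda>t. \<beta> ^ t * c)" using \<beta> by (intro summable_mult2 summable_geometric) simp
    show "\<exists>N. \<forall>n\<ge>N. norm (\<beta> ^ n * r n) \<le> \<beta> ^ n * c" using \<beta>(1) r by (simp add: abs_mult)
  qed
  then have "(\<lambda>T. \<bar>(\<Sum>t<T. \<beta> ^ t * r t) - (\<Sum>t<S. \<beta> ^ t * r t)\<bar>)
      \<longlonglongrightarrow> \<bar>(\<Sum>t. \<beta> ^ t * r t) - (\<Sum>t<S. \<beta> ^ t * r t)\<bar>"
    by (intro tendsto_intros summable_LIMSEQ)
  then show "\<bar>(\<Sum>t. \<beta> ^ t * r t) - (\<Sum>t<S. \<beta> ^ t * r t)\<bar> \<le> K * \<beta> ^ S"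
  proof (rule LIMSEQ_le_const2, intro exI allI impI)
    fix T assume "S \<le> T"
    have "K * (\<beta> ^ S - \<beta> ^ T) \<le> K * \<beta> ^ S"
      using \<open>0 \<le> K\<close> \<beta>(1) by (intro mult_left_mono) auto
    with incr[OF \<open>S \<le> T\<close>]
    show "\<bar>(\<Sum>t<T. \<beta> ^ t * r t) - (\<Sum>t<S. \<beta> ^ t * r t)\<bar> \<le> K * \<beta> ^ S" by linarith
  qed
qed

text \<open>An additive error \<open>e\<close> in the cost turns into a factor \<open>exp (\<bar>\<gamma>\<bar> * e)\<close>, whatever the sign
  of \<open>\<gamma>\<close>. The bound \<open>B\<close> ensures that the expectations exist.\<close>

lemma (in prob_space)
  fixes X Y :: "'a \<Rightarrow> real"
  assumes [measurable]: "X \<in> borel_measurable M" "Y \<in> borel_measurable M"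
    and bound: "\<And>\<omega>. \<bar>X \<omega>\<bar> \<le> B" "\<And>\<omega>. \<bar>Y \<omega>\<bar> \<le> B" and close: "\<And>\<omega>. \<bar>X \<omega> - Y \<omega>\<bar> \<le> e"
  shows expectation_diff_le: "\<bar>expectation X - expectation Y\<bar> \<le> e"
    and expectation_exp_le:
      "expectation (\<lambda>\<omega>. exp (\<gamma> * X \<omega>)) \<le> exp (\<bar>\<gamma>\<bar> * e) * expectation (\<lambda>\<omega>. exp (\<gamma> * Y \<omega>))"
proof -
  have int: "integrable M Z" "integrable M (\<lambda>\<omega>. exp (\<gamma> * Z \<omega>))"
    if [measurable]: "Z \<in> borel_measurable M" and Z: "\<And>\<omega>. \<bar>Z \<omega>\<bar> \<le> B" for Z
  proof -
    show "integrable M Z" using Z by (intro integrable_const_bound[where B=B]) auto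
    have "\<gamma> * Z \<omega> \<le> \<bar>\<gamma>\<bar> * B" for \<omega>
    proof -
      have "\<gamma> * Z \<omega> \<le> \<bar>\<gamma>\<bar> * \<bar>Z \<omega>\<bar>" by (metis abs_ge_self abs_mult)
      also have "\<dots> \<le> \<bar>\<gamma>\<bar> * B" using Z by (intro mult_left_mono) auto
      finally show ?thesis .
    qed
    then show "integrable M (\<lambda>\<omega>. exp (\<gamma> * Z \<omega>))"
      by (intro integrable_const_bound[where B="exp (\<bar>\<gamma>\<bar> * B)"]) auto
  qed
  note X = int[of X, OF assms(1) bound(1)] and Y = int[of Y, OF assms(2) bound(2)]
  have "\<bar>expectation X - expectation Y\<bar> = \<bar>expectation (\<lambda>\<omega>. X \<omega> - Y \<omega>)\<bar>"
    using X Y by simp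
  also have "\<dots> \<le> expectation (\<lambda>\<omega>. \<bar>X \<omega> - Y \<omega>\<bar>)"
    by (rule integral_abs_bound)
  also have "\<dots> \<le> expectation (\<lambda>\<omega>. e)"
    using X Y close by (intro integral_mono) auto
  finally show "\<bar>expectation X - expectation Y\<bar> \<le> e" by (simp add: prob_space)
  have "exp (\<gamma> * X \<omega>) \<le> exp (\<bar>\<gamma>\<bar> * e) * exp (\<gamma> * Y \<omega>)" for \<omega>
  proof -
    have "\<gamma> * (X \<omega> - Y \<omega>) \<le> \<bar>\<gamma>\<bar> * \<bar>X \<omega> - Y \<omega>\<bar>" by (metis abs_ge_self abs_mult)
    also have "\<dots> \<le> \<bar>\<gamma>\<bar> * e" using close by (intro mult_left_mono) auto
    finally show ?thesis by (simp add: mult_exp_exp algebra_simps)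
  qed
  then have "expectation (\<lambda>\<omega>. exp (\<gamma> * X \<omega>)) \<le> expectation (\<lambda>\<omega>. exp (\<bar>\<gamma>\<bar> * e) * exp (\<gamma> * Y \<omega>))"
    using X Y by (intro integral_mono) auto
  then show "expectation (\<lambda>\<omega>. exp (\<gamma> * X \<omega>)) \<le> exp (\<bar>\<gamma>\<bar> * e) * expectation (\<lambda>\<omega>. exp (\<gamma> * Y \<omega>))"
    by simp
qed

lemma measurable_discounted_cost:
  fixes p :: "'s::finite \<Rightarrow> 'a::finite \<Rightarrow> 's pmf" and R :: "'s \<times> 'a \<Rightarrow> real"
  shows "(\<lambda>\<omega>. \<Sum>t<T. \<beta> ^ t * R (\<omega> t)) \<in> borel_measurable (mdp_measure p \<pi> x)"
    and "(\<lambda>\<omega>. \<Sum>t. \<beta> ^ t * R (\<omega> t)) \<in> borel_measurable (mdp_measure p \<pi> x)"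
proof -
  have "(\<lambda>\<omega>. R (\<omega> t)) \<in> borel_measurable (PiM UNIV (\<lambda>_. count_space UNIV))" for t
    by (rule measurable_compose[OF measurable_component_singleton]) auto
  note [measurable] = this
  show "(\<lambda>\<omega>. \<Sum>t<T. \<beta> ^ t * R (\<omega> t)) \<in> borel_measurable (mdp_measure p \<pi> x)"
    and "(\<lambda>\<omega>. \<Sum>t. \<beta> ^ t * R (\<omega> t)) \<in> borel_measurable (mdp_measure p \<pi> x)"
    unfolding measurable_mdp_measure by measurable
qed

lemma
  fixes p :: "'s::finite \<Rightarrow> 'a::finite \<Rightarrow> 's pmf"
  shows policy_continuous_disc_cost_fin: "policy_continuous (disc_cost_fin p \<beta> x T R)"
    and policy_continuous_risk_cost_fin: "policy_continuous (risk_cost_fin p \<beta> \<gamma> x T R)"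
proof -
  have "policy_continuous (\<lambda>\<pi>. \<integral>\<omega>. g (restrict \<omega> {0..<T}) \<partial>mdp_measure p \<pi> x)" for g
    unfolding integral_history
    by (intro policy_continuous_polynomial policy_continuous_action_prob)
  from this[of "\<lambda>\<omega>. \<Sum>t<T. \<beta> ^ t * R (\<omega> t)"]
    this[of "\<lambda>\<omega>. exp (\<gamma> * (\<Sum>t<T. \<beta> ^ t * R (\<omega> t)))"]
  show "policy_continuous (disc_cost_fin p \<beta> x T R)" "policy_continuous (risk_cost_fin p \<beta> \<gamma> x T R)"
    by (simp_all add: disc_cost_fin_def[abs_def] risk_cost_fin_def[abs_def])
qed

text \<open>For a cost function bounded by \<open>c\<close>, the truncation errors below have bounds that do not depend on
  the policy; uniform convergence of the truncated costs rests on this.\<close>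

context
  fixes p :: "'s::finite \<Rightarrow> 'a::finite \<Rightarrow> 's pmf" and \<beta> c K :: real and x :: 's
    and R :: "'s \<times> 'a \<Rightarrow> real"
  assumes \<beta>: "0 < \<beta>" "\<beta> < 1" and R: "\<And>z. \<bar>R z\<bar> \<le> c" and K: "K = c / (1 - \<beta>)"
begin

lemma K_nonneg: "0 \<le> K"
  using order_trans[OF abs_ge_zero R[of undefined]] \<beta> K by simp

lemma discounted_cost_bound:
  "\<bar>\<Sum>t<T. \<beta> ^ t * R (\<omega> t)\<bar> \<le> K" "\<bar>\<Sum>t. \<beta> ^ t * R (\<omega> t)\<bar> \<le> K"
proof -
  have "K * (1 - \<beta> ^ T) \<le> K" using K_nonneg \<beta>(1) by (simp add: mult_left_le)
  then show "\<bar>\<Sum>t<T. \<beta> ^ t * R (\<omega> t)\<bar> \<le> K"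
    using discounted_increment[where r="\<lambda>t. R (\<omega> t)" and S=0 and T=T, OF \<beta> R K] by simp
  show "\<bar>\<Sum>t. \<beta> ^ t * R (\<omega> t)\<bar> \<le> K"
    using discounted_remainder[where r="\<lambda>t. R (\<omega> t)" and S=0, OF \<beta> R K] by simp
qed

lemmas perturb_facts = prob_space_mdp_measure measurable_discounted_cost discounted_cost_bound

lemma disc_cost_fin_increment:
  assumes "S \<le> T"
  shows "disc_cost_fin p \<beta> x T R \<pi> \<le> disc_cost_fin p \<beta> x S R \<pi> + K * (\<beta> ^ S - \<beta> ^ T)"
proof -
  have "\<bar>disc_cost_fin p \<beta> x T R \<pi> - disc_cost_fin p \<beta> x S R \<pi>\<bar> \<le> K * (\<beta> ^ S - \<beta> ^ T)"
    unfolding disc_cost_fin_def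
    by (intro prob_space.expectation_diff_le[where B=K] perturb_facts discounted_increment[OF \<beta> R K assms])
  then show ?thesis by linarith
qed

lemma disc_cost_approx:
  "\<bar>disc_cost_fin p \<beta> x T R \<pi> - disc_cost p \<beta> x R \<pi>\<bar> \<le> K * \<beta> ^ T"
  unfolding disc_cost_fin_def disc_cost_def
  by (subst abs_minus_commute)
    (intro prob_space.expectation_diff_le[where B=K] perturb_facts discounted_remainder[OF \<beta> R K])

lemma risk_cost_fin_increment:
  assumes "S \<le> T"
  shows "risk_cost_fin p \<beta> \<gamma> x T R \<pi> \<le>
    exp (\<bar>\<gamma>\<bar> * (K * (\<beta> ^ S - \<beta> ^ T))) * risk_cost_fin p \<beta> \<gamma> x S R \<pi>"
  unfolding risk_cost_fin_def
  by (intro prob_space.expectation_exp_le[where B=K] perturb_facts discounted_increment[OF \<beta> R K assms])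

lemma risk_cost_approx:
  "risk_cost p \<beta> \<gamma> x R \<pi> \<le> exp (\<bar>\<gamma>\<bar> * (K * \<beta> ^ T)) * risk_cost_fin p \<beta> \<gamma> x T R \<pi>"
  "risk_cost_fin p \<beta> \<gamma> x T R \<pi> \<le> exp (\<bar>\<gamma>\<bar> * (K * \<beta> ^ T)) * risk_cost p \<beta> \<gamma> x R \<pi>"
  unfolding risk_cost_fin_def risk_cost_def
  subgoal by (intro prob_space.expectation_exp_le[where B=K] perturb_facts discounted_remainder[OF \<beta> R K])
  subgoal
    by (intro prob_space.expectation_exp_le[where B=K] perturb_facts, subst abs_minus_commute)
      (intro discounted_remainder[OF \<beta> R K])
  done

lemma policy_continuous_disc_cost: "policy_continuous (disc_cost p \<beta> x R)"
proof (rule policy_continuous_uniform_limit[OF policy_continuous_disc_cost_fin _ disc_cost_approx])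
  show "(\<lambda>n. K * \<beta> ^ n) \<longlonglongrightarrow> 0"
    using \<beta> by (intro tendsto_mult_right_zero LIMSEQ_realpow_zero) auto
qed

text \<open>The truncated cost differs from the full one by a factor close to \<open>1\<close>. Since both are bounded
  uniformly in the policy, this multiplicative error is also a uniformly small additive one.\<close>

lemma policy_continuous_risk_cost: "policy_continuous (risk_cost p \<beta> \<gamma> x R)"
proof (rule policy_continuous_uniform_limit[OF policy_continuous_risk_cost_fin])
  \<comment> \<open>The risk costs are bounded by \<open>?k 0\<close> (infinite horizon) and \<open>?k 0 * ?k 0\<close> (finite horizon).
    The second bound is not sharp but follows from the first.\<close>
  let ?k = "\<lambda>n. exp (\<bar>\<gamma>\<bar> * (K * \<beta> ^ n))"
  have "?k \<longlonglongrightarrow> exp (\<bar>\<gamma>\<bar> * (K * 0))"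
    using \<beta> by (intro tendsto_intros LIMSEQ_realpow_zero) auto
  then have "(\<lambda>n. (?k n - 1) * (?k 0 * ?k 0)) \<longlonglongrightarrow> (1 - 1) * (?k 0 * ?k 0)"
    by (intro tendsto_intros) simp
  then show "(\<lambda>n. (?k n - 1) * (?k 0 * ?k 0)) \<longlonglongrightarrow> 0" by simp
  fix n \<pi>
  let ?J = "risk_cost p \<beta> \<gamma> x R \<pi>" and ?Jn = "risk_cost_fin p \<beta> \<gamma> x n R \<pi>"
  have k: "1 \<le> ?k m" for m using K_nonneg \<beta>(1) by simp
  have "?k n \<le> ?k 0" using K_nonneg \<beta> by (simp add: mult_left_le power_le_one mult_left_mono)
  have "risk_cost_fin p \<beta> \<gamma> x 0 R \<pi> = 1"
    by (simp add: risk_cost_fin_def prob_space.prob_space[OF prob_space_mdp_measure])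
  then have J: "?J \<le> ?k 0" using risk_cost_approx(1)[where T=0 and \<pi>=\<pi> and \<gamma>=\<gamma>] by simp
  have J0: "0 \<le> ?J" by (simp add: risk_cost_def)
  have Jn: "?Jn \<le> ?k 0 * ?k 0"
    using risk_cost_approx(2)[where T=n and \<pi>=\<pi> and \<gamma>=\<gamma>] mult_mono[OF \<open>?k n \<le> ?k 0\<close> J] J0 by simp
  have "?J - ?Jn \<le> (?k n - 1) * ?Jn" "?Jn - ?J \<le> (?k n - 1) * ?J"
    using risk_cost_approx[where T=n and \<pi>=\<pi> and \<gamma>=\<gamma>] by (simp_all add: algebra_simps)
  moreover have "(?k n - 1) * ?Jn \<le> (?k n - 1) * (?k 0 * ?k 0)"
    using k[of n] Jn by (intro mult_left_mono) auto
  moreover have "?J \<le> ?k 0 * ?k 0"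
  proof -
    have "1 * ?k 0 \<le> ?k 0 * ?k 0" using k[of 0] by (intro mult_right_mono) simp_all
    with J show ?thesis by linarith
  qed
  then have "(?k n - 1) * ?J \<le> (?k n - 1) * (?k 0 * ?k 0)"
    using k[of n] by (intro mult_left_mono) simp_all
  ultimately show "\<bar>?Jn - ?J\<bar> \<le> (?k n - 1) * (?k 0 * ?k 0)" by linarith
qed

end

section \<open>Existence of optimal policies\<close>

theorem theorem3p1:
  fixes p :: "'s::finite \<Rightarrow> 'a::finite \<Rightarrow> 's pmf"
    and \<beta> \<gamma> :: real
    and x :: 's
    and R :: "'s \<times> 'a \<Rightarrow> real"
    and M Mhat Mbar Mcheck :: nat
    and C Chat Cbar Ccheck :: "nat \<Rightarrow> 's \<times> 'a \<Rightarrow> real"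
    and b bhat bbar bcheck :: "nat \<Rightarrow> real"
    and Tbar Tcheck :: "nat \<Rightarrow> nat"
    and Cmax K :: real
    and KT :: "nat \<Rightarrow> real"
    and CC CChat CCbar CCcheck F :: "('s, 'a) mr_policy set"
    and CCminus CChatminus CCplus CChatplus Fminus Fplus :: "nat \<Rightarrow> ('s, 'a) mr_policy set"
  assumes beta: "0 < \<beta>" "\<beta> < 1"
    and gamma: "\<gamma> \<noteq> 0"
    and some_constraint: "M \<noteq> 0 \<or> Mhat \<noteq> 0 \<or> Mbar \<noteq> 0 \<or> Mcheck \<noteq> 0"
    and horizons: "\<forall>k\<in>{1..Mbar}. 0 < Tbar k" "\<forall>l\<in>{1..Mcheck}. 0 < Tcheck l"
    and Cmax_pos: "0 < Cmax"
    and bounds: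
      "\<forall>z. \<bar>R z\<bar> \<le> Cmax"
      "\<forall>i\<in>{1..M}. \<forall>z. \<bar>C i z\<bar> \<le> Cmax"
      "\<forall>j\<in>{1..Mhat}. \<forall>z. \<bar>Chat j z\<bar> \<le> Cmax"
      "\<forall>k\<in>{1..Mbar}. \<forall>z. \<bar>Cbar k z\<bar> \<le> Cmax"
      "\<forall>l\<in>{1..Mcheck}. \<forall>z. \<bar>Ccheck l z\<bar> \<le> Cmax"
    and K: "K = Cmax / (1 - \<beta>)"
    and KT: "\<And>T. KT T = exp (\<bar>\<gamma>\<bar> * K * \<beta> ^ T)"
    and CC: "CC = {\<pi>. \<forall>i\<in>{1..M}. disc_cost p \<beta> x (C i) \<pi> \<le> b i}"
    and CChat: "CChat = {\<pi>. \<forall>j\<in>{1..Mhat}. risk_cost p \<beta> \<gamma> x (Chat j) \<pi> \<le> bhat j}"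
    and CCbar: "CCbar = {\<pi>. \<forall>k\<in>{1..Mbar}. disc_cost_fin p \<beta> x (Tbar k) (Cbar k) \<pi> \<le> bbar k}"
    and CCcheck: "CCcheck =
      {\<pi>. \<forall>l\<in>{1..Mcheck}. risk_cost_fin p \<beta> \<gamma> x (Tcheck l) (Ccheck l) \<pi> \<le> bcheck l}"
    and CCminus: "\<And>T. CCminus T =
      {\<pi>. \<forall>i\<in>{1..M}. disc_cost_fin p \<beta> x T (C i) \<pi> \<le> b i - K * \<beta> ^ T}"
    and CChatminus: "\<And>T. CChatminus T =
      {\<pi>. \<forall>j\<in>{1..Mhat}. risk_cost_fin p \<beta> \<gamma> x T (Chat j) \<pi> \<le> bhat j / KT T}"
    and CCplus: "\<And>T. CCplus T =
      {\<pi>. \<forall>i\<in>{1..M}. disc_cost_fin p \<beta> x T (C i) \<pi> \<le> b i + K * \<beta> ^ T}"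
    and CChatplus: "\<And>T. CChatplus T =
      {\<pi>. \<forall>j\<in>{1..Mhat}. risk_cost_fin p \<beta> \<gamma> x T (Chat j) \<pi> \<le> bhat j * KT T}"
    and F: "F = CC \<inter> CChat \<inter> CCbar \<inter> CCcheck"
    and Fminus: "\<And>T. Fminus T = CCminus T \<inter> CChatminus T \<inter> CCbar \<inter> CCcheck"
    and Fplus: "\<And>T. Fplus T = CCplus T \<inter> CChatplus T \<inter> CCbar \<inter> CCcheck"
  shows "(F \<noteq> {} \<longrightarrow>
            (\<exists>\<pi>. is_arg_min (risk_cost p \<beta> \<gamma> x R) (\<lambda>\<pi>. \<pi> \<in> F) \<pi>) \<and>
            (\<forall>T>0. \<exists>\<pi>. is_arg_min (risk_cost_fin p \<beta> \<gamma> x T R) (\<lambda>\<pi>. \<pi> \<in> Fplus T) \<pi>)) \<and>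
         (\<forall>Tstar>0. Fminus Tstar \<noteq> {} \<longrightarrow>
            F \<noteq> {} \<and>
            (\<forall>T\<ge>Tstar. \<exists>\<pi>. is_arg_min (risk_cost_fin p \<beta> \<gamma> x T R) (\<lambda>\<pi>. \<pi> \<in> Fminus T) \<pi>))"
proof -
  have Cb: "\<And>z. \<bar>C i z\<bar> \<le> Cmax" if "i \<in> {1..M}" for i using bounds(2) that by blast
  have Chatb: "\<And>z. \<bar>Chat j z\<bar> \<le> Cmax" if "j \<in> {1..Mhat}" for j using bounds(3) that by blast
  have KT_pos: "0 < KT T" for T by (simp add: KT)
  have KT_eq: "exp (\<bar>\<gamma>\<bar> * (K * \<beta> ^ T)) = KT T" for T by (simp add: KT mult.assoc)

  have closed_fin: "policy_closed CCbar" "policy_closed CCcheck"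
    "\<And>T. policy_closed (CCminus T)" "\<And>T. policy_closed (CCplus T)"
    "\<And>T. policy_closed (CChatminus T)" "\<And>T. policy_closed (CChatplus T)"
    unfolding CCbar CCcheck CCminus CCplus CChatminus CChatplus
    by (intro policy_closed_sublevel policy_continuous_disc_cost_fin policy_continuous_risk_cost_fin)+
  have "policy_closed CC" unfolding CC
    by (intro policy_closed_sublevel policy_continuous_disc_cost[OF beta Cb K])
  moreover have "policy_closed CChat" unfolding CChat
    by (intro policy_closed_sublevel policy_continuous_risk_cost[OF beta Chatb K])
  ultimately have closed_F: "policy_closed F"
    unfolding F by (intro policy_closed_Int closed_fin)
  have closed_FT: "policy_closed (Fplus T)" "policy_closed (Fminus T)" for T
    unfolding Fplus Fminus by (intro policy_closed_Int closed_fin)+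

  \<comment> \<open>Relaxing by the truncation error keeps every feasible policy, and
    tightening by it leaves only feasible ones.\<close>
  have F_Fplus: "F \<subseteq> Fplus T" for T
  proof -
    have "CC \<subseteq> CCplus T"
    proof (unfold CC CCplus, safe)
      fix \<pi> i assume i: "i \<in> {1..M}" and "\<forall>i\<in>{1..M}. disc_cost p \<beta> x (C i) \<pi> \<le> b i"
      then have "disc_cost p \<beta> x (C i) \<pi> \<le> b i" by blast
      then show "disc_cost_fin p \<beta> x T (C i) \<pi> \<le> b i + K * \<beta> ^ T"
        using disc_cost_approx[where R="C i" and p=p and x=x and T=T and \<pi>=\<pi>,
            OF beta Cb[OF i] K] by linarith
    qed
    moreover have "CChat \<subseteq> CChatplus T"
    proof (unfold CChat CChatplus, safe)
      fix \<pi> j assume j: "j \<in> {1..Mhat}" and "\<forall>j\<in>{1..Mhat}. risk_cost p \<beta> \<gamma> x (Chat j) \<pi> \<le> bhat j"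
      then have "risk_cost p \<beta> \<gamma> x (Chat j) \<pi> * KT T \<le> bhat j * KT T"
        using KT_pos[of T] by (intro mult_right_mono) auto
      then show "risk_cost_fin p \<beta> \<gamma> x T (Chat j) \<pi> \<le> bhat j * KT T"
        using risk_cost_approx(2)[where R="Chat j" and p=p and \<gamma>=\<gamma> and x=x and T=T and \<pi>=\<pi>,
            OF beta Chatb[OF j] K]
        unfolding KT_eq by (simp add: mult.commute)
    qed
    ultimately show ?thesis unfolding F Fplus by blast
  qed

  have Fminus_F: "Fminus T \<subseteq> F" for T
  proof -
    have "CCminus T \<subseteq> CC"
    proof (unfold CC CCminus, safe)
      fix \<pi> i assume i: "i \<in> {1..M}"
        and "\<forall>i\<in>{1..M}. disc_cost_fin p \<beta> x T (C i) \<pi> \<le> b i - K * \<beta> ^ T"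
      then have "disc_cost_fin p \<beta> x T (C i) \<pi> \<le> b i - K * \<beta> ^ T" by blast
      then show "disc_cost p \<beta> x (C i) \<pi> \<le> b i"
        using disc_cost_approx[where R="C i" and p=p and x=x and T=T and \<pi>=\<pi>,
            OF beta Cb[OF i] K] by linarith
    qed
    moreover have "CChatminus T \<subseteq> CChat"
    proof (unfold CChat CChatminus, safe)
      fix \<pi> j assume j: "j \<in> {1..Mhat}"
        and "\<forall>j\<in>{1..Mhat}. risk_cost_fin p \<beta> \<gamma> x T (Chat j) \<pi> \<le> bhat j / KT T"
      then have "KT T * risk_cost_fin p \<beta> \<gamma> x T (Chat j) \<pi> \<le> bhat j"
        using KT_pos[of T] by (simp add: pos_le_divide_eq mult.commute)
      then show "risk_cost p \<beta> \<gamma> x (Chat j) \<pi> \<le> bhat j"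
        using risk_cost_approx(1)[where R="Chat j" and p=p and \<gamma>=\<gamma> and x=x and T=T and \<pi>=\<pi>,
            OF beta Chatb[OF j] K]
        unfolding KT_eq by linarith
    qed
    ultimately show ?thesis unfolding F Fminus by blast
  qed

  \<comment> \<open>From horizon \<open>S\<close> to horizon \<open>T\<close> a cost grows by at most \<open>K * (\<beta>\<^sup>S - \<beta>\<^sup>T)\<close>, which is exactly
    how much the margin in the constraint shrinks. For risk costs the same holds with the factor
    \<open>KT S / KT T\<close>.\<close>
  have Fminus_mono: "Fminus S \<subseteq> Fminus T" if "S \<le> T" for S T
  proof -
    have "CCminus S \<subseteq> CCminus T"
    proof (unfold CCminus, safe)
      fix \<pi> i assume i: "i \<in> {1..M}"
        and "\<forall>i\<in>{1..M}. disc_cost_fin p \<beta> x S (C i) \<pi> \<le> b i - K * \<beta> ^ S"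
      then have "disc_cost_fin p \<beta> x S (C i) \<pi> \<le> b i - K * \<beta> ^ S" by blast
      then show "disc_cost_fin p \<beta> x T (C i) \<pi> \<le> b i - K * \<beta> ^ T"
        using disc_cost_fin_increment[where R="C i" and p=p and x=x and \<pi>=\<pi>,
            OF beta Cb[OF i] K that]
        by (simp add: algebra_simps)
    qed
    moreover have "CChatminus S \<subseteq> CChatminus T"
    proof (unfold CChatminus, safe)
      fix \<pi> j assume j: "j \<in> {1..Mhat}"
        and *: "\<forall>j\<in>{1..Mhat}. risk_cost_fin p \<beta> \<gamma> x S (Chat j) \<pi> \<le> bhat j / KT S"
      have "exp (\<bar>\<gamma>\<bar> * (K * (\<beta> ^ S - \<beta> ^ T))) = KT S / KT T"
        by (simp add: KT exp_diff[symmetric] algebra_simps)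
      then have "risk_cost_fin p \<beta> \<gamma> x T (Chat j) \<pi> \<le>
          KT S / KT T * risk_cost_fin p \<beta> \<gamma> x S (Chat j) \<pi>"
        using risk_cost_fin_increment[where R="Chat j" and p=p and \<gamma>=\<gamma> and x=x and \<pi>=\<pi>,
            OF beta Chatb[OF j] K that] by simp
      also have "\<dots> \<le> KT S / KT T * (bhat j / KT S)"
        using * j KT_pos[of S] KT_pos[of T] by (intro mult_left_mono) auto
      also have "\<dots> = bhat j / KT T" using KT_pos[of S] by simp
      finally show "risk_cost_fin p \<beta> \<gamma> x T (Chat j) \<pi> \<le> bhat j / KT T" .
    qed
    ultimately show ?thesis unfolding Fminus by blast
  qed

  show ?thesis
  proof (intro conjI impI allI)
    assume "F \<noteq> {}"
    then show "\<exists>\<pi>. is_arg_min (risk_cost p \<beta> \<gamma> x R) (\<lambda>\<pi>. \<pi> \<in> F) \<pi>"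
      using bounds(1)
      by (intro policy_continuous_attains_min policy_continuous_risk_cost[OF beta _ K] closed_F) auto
    show "\<exists>\<pi>. is_arg_min (risk_cost_fin p \<beta> \<gamma> x T R) (\<lambda>\<pi>. \<pi> \<in> Fplus T) \<pi>" for T
      using \<open>F \<noteq> {}\<close> F_Fplus[of T]
      by (intro policy_continuous_attains_min policy_continuous_risk_cost_fin closed_FT) auto
  next
    fix Tstar :: nat assume ne: "Fminus Tstar \<noteq> {}"
    then show "F \<noteq> {}" using Fminus_F by blast
    fix T assume "Tstar \<le> T"
    then show "\<exists>\<pi>. is_arg_min (risk_cost_fin p \<beta> \<gamma> x T R) (\<lambda>\<pi>. \<pi> \<in> Fminus T) \<pi>"
      using ne Fminus_mono[of Tstar T]
      by (intro policy_continuous_attains_min policy_continuous_risk_cost_fin closed_FT) auto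
  qed
qed

end
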